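(* Let $\boldsymbol M$ be the $(d\times r)$ mixture model with coefficient matrix $A=(a_{jk})$ and factors $\boldsymbol Z^{(1)},\dots,\boldsymbol Z^{(r)}$, and let $J_k=\{j\in D:a_{jk}>0\}$ for $k\in R$. The set of extreme directions of the random vector $\boldsymbol M$ is $$\mathcal R=\{J\subseteq D:\ J=J_k\text{ for some }k\in R\}.$$
   Context: $D=\{1,\dots,d\}$, $R=\{1,\dots,r\}$, $\mathbb E=[0,\infty)^d\setminus\{\boldsymbol 0\}$, $\mathbb E_J=\{\boldsymbol x\in\mathbb E:x_j>0\text{ iff }j\in J\}$. For a random vector whose cdf $G^*$ is a multivariate extreme-value (mev) distribution with unit-Fréchet margins ($e^{-1/x}$, $x>0$), the exponent measure $\mu$ is the unique Borel measure on $\mathbb E$ with $G^*(\boldsymbol x)=\exp\{-\mu(\mathbb E\setminus[\boldsymbol 0,\boldsymbol x])\}$, $\boldsymbol x\in[\boldsymbol 0,\boldsymbol\infty]$. A non-empty $J\subseteq D$ is an extreme direction of the random vector (or of $\mu$) if $\mu(\mathbb E_J)>0$. Mixture model: let $\boldsymbol Z^{(1)},\ldots,\boldsymbol Z^{(r)}$ be independent random vectors in $\mathbb R^d$, each $\boldsymbol Z^{(k)}=(Z^{(k)}_1,\dots,Z^{(k)}_d)$ having an mev distribution with unit-Fréchet margins and single extreme direction $D$ (i.e. $D$ is its only extreme direction). Let $A=(a_{jk})_{j\in D;k\in R}\in[0,1]^{d\times r}$ have unit row sums $\sum_{k=1}^r a_{jk}=1$ for all $j\in D$ and positive column sums $\sum_{j=1}^d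 a_{jk}>0$ for all $k\in R$. The mixture model is $$\boldsymbol M=\Big(\max_{k\in R}\{a_{1k}Z_1^{(k)}\},\ldots,\max_{k\in R}\{a_{dk}Z_d^{(k)}\}\Big).$$ The vector $\boldsymbol M$ has an mev distribution with unit-Fréchet margins. *)

theory Defs
  imports "HOL-Probability.Probability"
begin

(* Vectors in R^d are "real ^ 'd" with a finite index type 'd playing the role of D = {1..d};
   the order on vectors is the componentwise one, so {..x} is the lower orthant below x.
   Distributions are represented by their laws, i.e. Borel probability measures on R^d. *)

definition mcdf :: "(real ^ 'd) measure \<Rightarrow> real ^ 'd \<Rightarrow> real" where
  "mcdf \<nu> x = measure \<nu> {..x}"

(* The lower orthant with corner in the extended space, used for x in [0,oo]^d. *)
definition ext_orthant :: "ereal ^ 'd \<Rightarrow> (real ^ 'd) set" where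
  "ext_orthant x = {y. \<forall>j. ereal (y $ j) \<le> x $ j}"

(* mcdf F (..) ^ n is the cdf of the componentwise maximum of n independent vectors with law F,
   after an affine normalisation: mev laws are the weak limits of such normalised maxima
   that have non-degenerate margins. *)
definition mev :: "(real ^ 'd) measure \<Rightarrow> bool" where
  "mev \<nu> \<longleftrightarrow>
     prob_space \<nu> \<and> sets \<nu> = sets borel \<and>
     (\<forall>j c. measure \<nu> {y. y $ j = c} \<noteq> 1) \<and>
     (\<exists>F a b. prob_space F \<and> sets F = sets borel \<and>
        (\<forall>n j. 0 < a n $ j) \<and>
        (\<forall>x. isCont (mcdf \<nu>) x \<longrightarrow>
           (\<lambda>n. mcdf F (\<chi> j. a n $ j * x $ j + b n $ j) ^ n) \<longlonglongrightarrow> mcdf \<nu> x))"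

definition unit_frechet_margins :: "(real ^ 'd) measure \<Rightarrow> bool" where
  "unit_frechet_margins \<nu> \<longleftrightarrow>
     (\<forall>j x. cdf (distr \<nu> borel (\<lambda>y. y $ j)) x = (if 0 < x then exp (- 1 / x) else 0))"

definition EE :: "(real ^ 'd) set" where
  "EE = {x. \<forall>j. 0 \<le> x $ j} - {0}"

definition EE_face :: "'d set \<Rightarrow> (real ^ 'd) set" where
  "EE_face J = {x \<in> EE. \<forall>j. 0 < x $ j \<longleftrightarrow> j \<in> J}"

(* t |-> exp (-t) on [0,oo], with exp (-oo) = 0 *)
definition exp_neg :: "ennreal \<Rightarrow> real" where
  "exp_neg t = (if t = \<infinity> then 0 else exp (- enn2real t))"

definition is_exponent_measure :: "(real ^ 'd) measure \<Rightarrow> (real ^ 'd) measure \<Rightarrow> bool" where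
  "is_exponent_measure \<nu> \<mu> \<longleftrightarrow>
     sets \<mu> = sets (restrict_space borel EE) \<and>
     (\<forall>x. (\<forall>j. 0 \<le> x $ j) \<longrightarrow>
        measure \<nu> (ext_orthant x) = exp_neg (emeasure \<mu> (EE - ext_orthant x)))"

(* For unit-Frechet margins the exponent measure is unique (all sets EE - {..x} with x > 0
   have finite measure), so the existential quantifier just names it. *)
definition extreme_directions :: "(real ^ 'd) measure \<Rightarrow> 'd set set" where
  "extreme_directions \<nu> =
     {J. J \<noteq> {} \<and> (\<exists>\<mu>. is_exponent_measure \<nu> \<mu> \<and> emeasure \<mu> (EE_face J) > 0)}"

definition mixture_model ::
  "real ^ 'r ^ 'd \<Rightarrow> ('r::finite \<Rightarrow> 'a \<Rightarrow> real ^ 'd) \<Rightarrow> 'a \<Rightarrow> real ^ 'd" where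
  "mixture_model A Z \<omega> = (\<chi> j. Max (range (\<lambda>k. A $ j $ k * Z k \<omega> $ j)))"

end

theory Submission imports Defs begin

text \<open>Independence turns the cdf of the mixture model into the product of the factor cdfs at rescaled
  points, so the sum of the images of the factors' exponent measures under scaling by the columns
  of \<open>A\<close> is an exponent measure of the mixture. Each factor measure lives on the points
  with all coordinates positive, which column \<open>k\<close> moves to the face of its support. Uniqueness of
  the exponent measure, needed because an extreme direction is witnessed by any exponent measure,
  holds since complements of orthants with positive corner have finite measure.\<close>

section \<open>Algebra of \<open>exp_neg\<close> on the extended half-line\<close>

lemma exp_neg_pos_iff: "0 < exp_neg t \<longleftrightarrow> t < \<infinity>"
  by (auto simp: exp_neg_def less_top)

text \<open>Lets equal orthant probabilities be read as equal masses: the value 0 occurs only at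
  infinite mass, and \<open>exp\<close> is injective on the finite ones.\<close>

lemma exp_neg_inj: "exp_neg s = exp_neg t \<longleftrightarrow> s = t"
proof
  assume eq: "exp_neg s = exp_neg t"
  show "s = t"
  proof (cases "s = \<infinity>")
    case True
    then show ?thesis using eq by (auto simp: exp_neg_def split: if_splits)
  next
    case False
    then have t: "t \<noteq> \<infinity>" and "enn2real s = enn2real t"
      using eq by (auto simp: exp_neg_def split: if_splits)
    then show ?thesis using False by (metis ennreal_enn2real_if infinity_ennreal_def)
  qed
qed simp

lemma exp_neg_add: "exp_neg (s + t) = exp_neg s * exp_neg t"
proof (cases "s = \<infinity> \<or> t = \<infinity>")
  case True
  then show ?thesis by (auto simp: exp_neg_def)
next
  case False
  then have "enn2real (s + t) = enn2real s + enn2real t"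
    by (intro enn2real_plus) (auto simp: less_top)
  then show ?thesis using False by (auto simp: exp_neg_def exp_add[symmetric])
qed

lemma exp_neg_sum: "finite K \<Longrightarrow> exp_neg (\<Sum>k\<in>K. f k) = (\<Prod>k\<in>K. exp_neg (f k))"
  by (induction K rule: finite_induct) (simp_all add: exp_neg_add, simp add: exp_neg_def)

section \<open>Borel measurability of orthants and faces\<close>

lemma ext_orthant_measurable [measurable]:
  "ext_orthant (x :: ereal ^ 'd::finite) \<in> sets borel"
  unfolding ext_orthant_def by measurable

lemma ext_orthant_ereal: "ext_orthant (\<chi> j. ereal (x $ j)) = {..x}"
  by (auto simp: ext_orthant_def less_eq_vec_def)

lemma EE_measurable [measurable]: "(EE :: (real ^ 'd::finite) set) \<in> sets borel"
proof -
  have "{x :: real ^ 'd. \<forall>j. 0 \<le> x $ j} \<in> sets borel" by measurable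
  then show ?thesis unfolding EE_def by simp
qed

lemma EE_face_measurable [measurable]:
  "EE_face (J :: 'd::finite set) \<in> sets borel"
proof -
  have "EE_face J = EE \<inter> {x. \<forall>j. 0 < x $ j \<longleftrightarrow> j \<in> J}" by (auto simp: EE_face_def)
  moreover have "{x :: real ^ 'd. \<forall>j. 0 < x $ j \<longleftrightarrow> j \<in> J} \<in> sets borel" by measurable
  ultimately show ?thesis by simp
qed

lemma EE_face_subset: "EE_face J \<subseteq> EE"
  by (auto simp: EE_face_def)

lemma EE_face_empty: "EE_face {} = {}"
  by (auto simp: EE_face_def EE_def vec_eq_iff less_le)

lemma sets_restrict_EE:
  "B \<in> sets (restrict_space borel (EE :: (real ^ 'd::finite) set)) \<longleftrightarrow> B \<in> sets borel \<and> B \<subseteq> EE"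
  by (subst sets_restrict_space_iff) auto

section \<open>Exponent measures and their finiteness away from the origin\<close>

lemma is_exponent_measureD:
  fixes \<nu> :: "(real ^ 'd::finite) measure"
  assumes "is_exponent_measure \<nu> \<mu>"
  shows "B \<in> sets \<mu> \<longleftrightarrow> B \<in> sets borel \<and> B \<subseteq> EE"
    and "space \<mu> = EE"
    and "(\<And>j. 0 \<le> x $ j) \<Longrightarrow> measure \<nu> (ext_orthant x) = exp_neg (emeasure \<mu> (EE - ext_orthant x))"
proof -
  have s: "sets \<mu> = sets (restrict_space borel EE)"
    using assms by (simp add: is_exponent_measure_def)
  then show "B \<in> sets \<mu> \<longleftrightarrow> B \<in> sets borel \<and> B \<subseteq> EE"
    by (simp add: sets_restrict_EE)
  show "space \<mu> = EE" using sets_eq_imp_space_eq[OF s] by simp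
  show "measure \<nu> (ext_orthant x) = exp_neg (emeasure \<mu> (EE - ext_orthant x))" if "\<And>j. 0 \<le> x $ j"
    using assms that by (simp add: is_exponent_measure_def)
qed

lemma exponent_measure_orthant_finite:
  fixes \<nu> :: "(real ^ 'd::finite) measure"
  assumes \<mu>: "is_exponent_measure \<nu> \<mu>" and fr: "unit_frechet_margins \<nu>"
    and sets: "sets \<nu> = sets borel" and pos: "\<And>j. 0 < x $ j"
  shows "emeasure \<mu> (EE - ext_orthant x) < \<infinity>"
proof -
  \<comment> \<open>\<open>e j\<close> keeps the bound on coordinate \<open>j\<close> only, so for
    finite \<open>x $ j\<close> its orthant probability is a value of the \<open>j\<close>-th
    marginal cdf.\<close>
  define e where "e j = (\<chi> i. if i = j then x $ j else \<infinity>)" for j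
  have e_pos: "0 \<le> e j $ i" for i j using pos[of j] by (auto simp: e_def)
  have e: "ext_orthant (e j) = {y. ereal (y $ j) \<le> x $ j}" for j
    by (auto simp: ext_orthant_def e_def)
  have fin: "emeasure \<mu> (EE - ext_orthant (e j)) < \<infinity>" for j
  proof (cases "x $ j")
    case (real c)
    then have c: "0 < c" using pos[of j] by simp
    have [measurable]: "(\<lambda>y. y $ j) \<in> measurable \<nu> borel"
      by (subst measurable_cong_sets[OF sets refl]) measurable
    have "exp (- 1 / c) = measure (distr \<nu> borel (\<lambda>y. y $ j)) {..c}"
      using fr c unfolding unit_frechet_margins_def cdf_def by auto
    also have "\<dots> = measure \<nu> ((\<lambda>y. y $ j) -` {..c} \<inter> space \<nu>)"
      by (rule measure_distr) auto
    also have "(\<lambda>y. y $ j) -` {..c} \<inter> space \<nu> = ext_orthant (e j)"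
      using sets_eq_imp_space_eq[OF sets] by (auto simp: e real)
    also have "measure \<nu> (ext_orthant (e j)) = exp_neg (emeasure \<mu> (EE - ext_orthant (e j)))"
      using is_exponent_measureD(3)[OF \<mu> e_pos] .
    \<comment> \<open>The marginal probability is strictly positive, whereas \<open>exp_neg\<close>
      is 0 at infinite mass.\<close>
    finally show ?thesis by (metis exp_gt_zero exp_neg_pos_iff)
  next
    case PInf
    then have "EE - ext_orthant (e j) = {}" by (auto simp: e)
    then show ?thesis by (simp only: emeasure_empty) simp
  next
    case MInf
    then show ?thesis using pos[of j] by simp
  qed
  have [simp]: "EE - ext_orthant y \<in> sets \<mu>" for y
    by (simp add: is_exponent_measureD(1)[OF \<mu>] Diff_subset)
  have "EE - ext_orthant x \<subseteq> (\<Union>j. EE - ext_orthant (e j))"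
    unfolding e by (auto simp: ext_orthant_def)
  then have "emeasure \<mu> (EE - ext_orthant x) \<le> emeasure \<mu> (\<Union>j. EE - ext_orthant (e j))"
    by (intro emeasure_mono sets.finite_UN) auto
  also have "\<dots> \<le> (\<Sum>j\<in>UNIV. emeasure \<mu> (EE - ext_orthant (e j)))"
    by (intro emeasure_subadditive_finite) auto
  also have "\<dots> < \<infinity>" using fin by (simp add: less_top)
  finally show ?thesis .
qed

section \<open>Uniqueness of the exponent measure\<close>

text \<open>Lower orthants form an intersection-stable generator of the Borel sets. Positive corners
  suffice: a nonnegative corner is a limit of positive ones from above, and an orthant with a
  negative corner coordinate misses the nonnegative cone, hence is null.\<close>

lemma finite_borel_measure_eqI_orthants:
  fixes M N :: "(real ^ 'd::finite) measure"
  assumes fin: "finite_measure M" "finite_measure N"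
    and sets: "sets M = sets borel" "sets N = sets borel"
    and null: "emeasure M (- {x. \<forall>j. 0 \<le> x $ j}) = 0" "emeasure N (- {x. \<forall>j. 0 \<le> x $ j}) = 0"
    and eq: "\<And>x. (\<And>j. 0 < x $ j) \<Longrightarrow> emeasure M {..x} = emeasure N {..x}"
  shows "M = N"
proof -
  have meas: "- {x :: real ^ 'd. \<forall>j. 0 \<le> x $ j} \<in> sets borel" by measurable
  have nonneg: "emeasure M {..x} = emeasure N {..x}" for x
  proof (cases "\<forall>j. 0 \<le> x $ j")
    case True
    \<comment> \<open>Adding 1/(m+1) makes every corner coordinate strictly positive; the orthants
      shrink to \<open>{..x}\<close>, and continuity from above applies since both measures are
      finite.\<close>
    define D where "D m = {..\<chi> j. x $ j + 1 / Suc m}" for m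
    have dec: "decseq D"
    proof (rule decseq_SucI)
      have "(\<chi> j. x $ j + 1 / Suc (Suc m)) \<le> (\<chi> j. x $ j + 1 / Suc m)" for m
        by (auto simp: less_eq_vec_def frac_le)
      then show "D (Suc m) \<subseteq> D m" for m by (simp add: D_def)
    qed
    have "{..x} = (\<Inter>m. D m)"
    proof safe
      fix y assume y: "y \<in> (\<Inter>m. D m)"
      have "y $ j \<le> x $ j" for j
      proof (rule field_le_epsilon)
        fix e :: real assume "0 < e"
        then obtain m where "1 / Suc m < e"
          using nat_approx_posE by (metis of_nat_Suc)
        moreover have "y $ j \<le> x $ j + 1 / Suc m"
          using y by (auto simp: D_def less_eq_vec_def)
        ultimately show "y $ j \<le> x $ j + e" by linarith
      qed
      then show "y \<le> x" by (simp add: less_eq_vec_def)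
    next
      fix y m assume "y \<le> x"
      then show "y \<in> D m"
        by (auto simp: D_def less_eq_vec_def intro: order_trans)
    qed
    moreover have "emeasure M (D m) = emeasure N (D m)" for m
      unfolding D_def by (rule eq) (use True in \<open>auto intro: add_nonneg_pos\<close>)
    moreover have "(INF m. emeasure M (D m)) = emeasure M (\<Inter>m. D m)"
      "(INF m. emeasure N (D m)) = emeasure N (\<Inter>m. D m)"
      using fin sets
      by (auto intro!: INF_emeasure_decseq[OF _ dec] simp: finite_measure.emeasure_finite,
          auto simp: D_def)
    ultimately show ?thesis by simp
  next
    case False
    then obtain j where j: "x $ j < 0" by (auto simp: not_le)
    have sub: "{..x} \<subseteq> - {x. \<forall>j. 0 \<le> x $ j}"
    proof
      fix y assume "y \<in> {..x}"
      then have "y $ j \<le> x $ j" by (simp add: less_eq_vec_def)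
      then show "y \<in> - {x. \<forall>j. 0 \<le> x $ j}" using j by (auto simp: not_le intro!: exI[of _ j])
    qed
    have "emeasure M {..x} \<le> 0" "emeasure N {..x} \<le> 0"
      using emeasure_mono[OF sub, of M] emeasure_mono[OF sub, of N] null meas sets by simp_all
    then show ?thesis by simp
  qed
  show ?thesis
  proof (rule measure_eqI_generator_eq[where E = "range atMost" and \<Omega> = UNIV
        and A = "\<lambda>n. {..\<chi> j. real n}"])
    show "Int_stable (range (atMost :: real ^ 'd \<Rightarrow> _))"
    proof (rule Int_stableI)
      fix B C :: "(real ^ 'd) set" assume "B \<in> range atMost" "C \<in> range atMost"
      then obtain b c where "B = {..b}" "C = {..c}" by auto
      then have "B \<inter> C = {..inf b c}" by auto
      then show "B \<inter> C \<in> range atMost" by simp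
    qed
    show "sets M = sigma_sets UNIV (range atMost)" "sets N = sigma_sets UNIV (range atMost)"
      using sets by (auto simp: borel_eq_atMost)
    show "(\<Union>n. {..\<chi> j. real n}) = (UNIV :: (real ^ 'd) set)"
    proof safe
      fix x :: "real ^ 'd"
      obtain n where "Max (range (($) x)) \<le> real n" using real_arch_simple by blast
      then have "x \<le> (\<chi> j. real n)" by (auto simp: less_eq_vec_def)
      then show "x \<in> (\<Union>n. {..\<chi> j. real n})" by auto
    qed simp
    show "emeasure M {..\<chi> j. real n} \<noteq> \<infinity>" for n
      using fin(1) by (simp add: finite_measure.emeasure_finite)
  qed (use nonneg in auto)
qed

text \<open>An exponent measure may be infinite near the origin, so the comparison is made on the
  sets \<open>U n\<close>, which have finite mass and increase to \<open>EE\<close>. There the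
  orthant masses are differences of masses of orthant complements, and these are determined by
  \<nu>.\<close>

lemma exponent_measure_unique:
  fixes \<nu> :: "(real ^ 'd::finite) measure"
  assumes \<mu>: "is_exponent_measure \<nu> \<mu>" and \<mu>': "is_exponent_measure \<nu> \<mu>'"
    and pos: "\<And>x. (\<And>j. 0 < x $ j) \<Longrightarrow> 0 < measure \<nu> (ext_orthant x)"
  shows "\<mu> = \<mu>'"
proof -
  have eq: "emeasure \<mu> (EE - ext_orthant x) = emeasure \<mu>' (EE - ext_orthant x)"
    if "\<And>j. 0 \<le> x $ j" for x
    using is_exponent_measureD(3)[OF \<mu> that] is_exponent_measureD(3)[OF \<mu>' that]
    by (simp add: exp_neg_inj)
  define u :: "nat \<Rightarrow> real ^ 'd" where "u n = (\<chi> j. 1 / Suc n)" for n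
  define U where "U n = EE - {..u n}" for n
  have U [measurable]: "U n \<in> sets borel" for n by (simp add: U_def)
  \<comment> \<open>The trace on \<open>U n\<close> is pushed forward to the Borel sets of the whole
    space, so that the criterion for finite Borel measures applies.\<close>
  define N where "N \<kappa> n = distr (restrict_space \<kappa> (U n)) borel (\<lambda>x. x)"
    for \<kappa> :: "(real ^ 'd) measure" and n
  have N: "emeasure (N \<kappa> n) B = emeasure \<kappa> (B \<inter> U n)"
    if \<kappa>: "is_exponent_measure \<nu> \<kappa>" and B: "B \<in> sets borel" for \<kappa> n B
  proof -
    have UE: "U n \<subseteq> EE" by (auto simp: U_def)
    note \<kappa>' = is_exponent_measureD(1,2)[OF \<kappa>]
    have "U n \<inter> space \<kappa> \<in> sets \<kappa>" using UE by (simp add: \<kappa>' Int_absorb2)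
    moreover have "(\<lambda>x. x) \<in> measurable (restrict_space \<kappa> (U n)) borel"
    proof (rule measurableI)
      fix C :: "(real ^ 'd) set" assume "C \<in> sets borel"
      then show "(\<lambda>x. x) -` C \<inter> space (restrict_space \<kappa> (U n)) \<in> sets (restrict_space \<kappa> (U n))"
        using UE calculation by (auto simp: sets_restrict_space_iff space_restrict_space \<kappa>')
    qed simp
    ultimately show ?thesis using B UE
      by (simp add: N_def emeasure_distr emeasure_restrict_space space_restrict_space \<kappa>'
          Int_absorb2 Int_absorb1)
  qed
  have box: "emeasure \<kappa> ({..x} \<inter> U n) =
      emeasure \<kappa> (EE - {..inf x (u n)}) - emeasure \<kappa> (EE - {..x})"
    and fin: "emeasure \<kappa> (U n) < \<infinity>"
    if \<kappa>: "is_exponent_measure \<nu> \<kappa>" and x: "\<And>j. 0 < x $ j" for \<kappa> n x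
  proof -
    have fin: "emeasure \<kappa> (EE - {..y}) < \<infinity>" if "\<And>j. 0 < y $ j" for y :: "real ^ 'd"
      using pos[of "\<chi> j. ereal (y $ j)"] is_exponent_measureD(3)[OF \<kappa>, of "\<chi> j. ereal (y $ j)"] that
      by (simp add: exp_neg_pos_iff less_imp_le ext_orthant_ereal)
    then show "emeasure \<kappa> (U n) < \<infinity>" by (simp add: U_def u_def)
    \<comment> \<open>A point below \<open>x\<close> lies outside \<open>{..u n}\<close> exactly
      when it lies outside \<open>{..inf x (u n)}\<close>. The subtraction of masses is legitimate
      because the subtracted one is finite.\<close>
    have "{..x} \<inter> U n = (EE - {..inf x (u n)}) - (EE - {..x})"
      by (auto simp: U_def)
    then show "emeasure \<kappa> ({..x} \<inter> U n) =
      emeasure \<kappa> (EE - {..inf x (u n)}) - emeasure \<kappa> (EE - {..x})"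
      using fin[OF x] by (simp add: emeasure_Diff is_exponent_measureD(1)[OF \<kappa>] less_top
          Diff_subset Diff_mono)
  qed
  have N_eq: "N \<mu> n = N \<mu>' n" for n
  proof (rule finite_borel_measure_eqI_orthants)
    have *: "finite_measure (N \<kappa> n)" "emeasure (N \<kappa> n) (- {x. \<forall>j. 0 \<le> x $ j}) = 0"
      if \<kappa>: "is_exponent_measure \<nu> \<kappa>" for \<kappa>
    proof -
      show "finite_measure (N \<kappa> n)"
        \<comment> \<open>The all-ones vector is just some positive corner, discharging the premise
          that \<open>fin\<close> shares with \<open>box\<close>.\<close>
        using fin[OF \<kappa>, of "\<chi> j. 1" n] N[OF \<kappa>, of UNIV n]
        by (intro finite_measureI) (simp add: N_def less_top)
      have "- {x. \<forall>j. 0 \<le> x $ j} \<inter> U n = {}" by (auto simp: U_def EE_def)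
      moreover have "- {x :: real ^ 'd. \<forall>j. 0 \<le> x $ j} \<in> sets borel" by measurable
      ultimately show "emeasure (N \<kappa> n) (- {x. \<forall>j. 0 \<le> x $ j}) = 0"
        by (simp only: N[OF \<kappa>] emeasure_empty)
    qed
    show "finite_measure (N \<mu> n)" "emeasure (N \<mu> n) (- {x. \<forall>j. 0 \<le> x $ j}) = 0" using *[OF \<mu>] by auto
    show "finite_measure (N \<mu>' n)" "emeasure (N \<mu>' n) (- {x. \<forall>j. 0 \<le> x $ j}) = 0" using *[OF \<mu>'] by auto
    show "emeasure (N \<mu> n) {..x} = emeasure (N \<mu>' n) {..x}" if x: "\<And>j. 0 < x $ j" for x
    proof -
      have "0 \<le> inf x (u n) $ j" for j using x[of j] by (simp add: inf_vec_def u_def)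
      then show ?thesis
        using eq[of "\<chi> j. ereal (inf x (u n) $ j)"] eq[of "\<chi> j. ereal (x $ j)"] x
        by (simp add: N[OF \<mu>] N[OF \<mu>'] box[OF \<mu> x] box[OF \<mu>' x] ext_orthant_ereal less_imp_le)
    qed
  qed (simp_all add: N_def)
  have cover: "(\<Union>n. U n) = EE"
  proof safe
    fix y :: "real ^ 'd" assume y: "y \<in> EE"
    \<comment> \<open>A nonzero point of the cone has a positive coordinate, which eventually
      exceeds the corner 1/(n+1).\<close>
    then obtain j where "0 < y $ j" by (auto simp: EE_def vec_eq_iff less_le)
    then obtain n where "1 / Suc n < y $ j" using nat_approx_posE by (metis of_nat_Suc)
    then have "\<not> y \<le> u n" by (auto simp: less_eq_vec_def u_def not_le)
    then show "y \<in> (\<Union>n. U n)" using y by (auto simp: U_def)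
  qed (auto simp: U_def)
  have inc: "incseq U"
  proof (rule incseq_SucI)
    have "u (Suc n) \<le> u n" for n by (auto simp: u_def less_eq_vec_def frac_le)
    then show "U n \<le> U (Suc n)" for n unfolding U_def by (auto intro: order_trans)
  qed
  show ?thesis
  proof (rule measure_eqI)
    show "sets \<mu> = sets \<mu>'" using \<mu> \<mu>' by (simp add: is_exponent_measure_def)
    fix B assume "B \<in> sets \<mu>"
    then have B: "B \<in> sets borel" "B \<subseteq> EE" by (auto simp: is_exponent_measureD(1)[OF \<mu>])
    \<comment> \<open>Continuity from below recovers the full measure from its traces.\<close>
    have "emeasure \<kappa> B = (SUP n. emeasure (N \<kappa> n) B)" if \<kappa>: "is_exponent_measure \<nu> \<kappa>" for \<kappa>
    proof -
      have "(SUP n. emeasure \<kappa> (B \<inter> U n)) = emeasure \<kappa> (\<Union>n. B \<inter> U n)"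
        using inc B by (intro SUP_emeasure_incseq)
          (auto simp: is_exponent_measureD(1)[OF \<kappa>] incseq_def)
      also have "(\<Union>n. B \<inter> U n) = B" using cover B by auto
      finally show ?thesis using B by (simp add: N[OF \<kappa>])
    qed
    then show "emeasure \<mu> B = emeasure \<mu>' B" using \<mu> \<mu>' N_eq by simp
  qed
qed

section \<open>Concentration of the factor measures on the open face\<close>

text \<open>The finitely many faces cover \<open>EE\<close>, each point lying on the face of its
  positive coordinates. A proper nonempty face of positive mass would be a further extreme
  direction, witnessed by \<mu> itself.\<close>

lemma exponent_measure_full_support:
  fixes \<nu> :: "(real ^ 'd::finite) measure"
  assumes \<mu>: "is_exponent_measure \<nu> \<mu>" and dir: "extreme_directions \<nu> \<subseteq> {UNIV}"
  shows "emeasure \<mu> (EE - EE_face UNIV) = 0"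
proof -
  have null: "emeasure \<mu> (EE_face J) = 0" if "J \<noteq> UNIV" for J
  proof (cases "J = {}")
    case False
    then have "J \<notin> extreme_directions \<nu>" using dir that by auto
    then show ?thesis using \<mu> False by (auto simp: extreme_directions_def)
  qed (simp add: EE_face_empty)
  have meas: "EE_face J \<in> sets \<mu>" for J
    by (simp add: is_exponent_measureD(1)[OF \<mu>] EE_face_subset)
  have "EE - EE_face UNIV \<subseteq> (\<Union>J\<in>- {UNIV :: 'd set}. EE_face J)"
  proof
    fix z :: "real ^ 'd" assume z: "z \<in> EE - EE_face UNIV"
    then have "z \<in> EE_face {j. 0 < z $ j}" "{j. 0 < z $ j} \<noteq> UNIV" by (auto simp: EE_face_def)
    then show "z \<in> (\<Union>J\<in>- {UNIV}. EE_face J)" by (intro UN_I) simp_all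
  qed
  then have "emeasure \<mu> (EE - EE_face UNIV) \<le> emeasure \<mu> (\<Union>J\<in>- {UNIV}. EE_face J)"
    by (rule emeasure_mono) (rule sets.finite_UN[OF finite meas])
  also have "\<dots> \<le> (\<Sum>J\<in>- {UNIV}. emeasure \<mu> (EE_face J))"
    by (rule emeasure_subadditive_finite) (simp_all add: meas image_subsetI)
  also have "\<dots> = 0" using null by simp
  finally show ?thesis by simp
qed

section \<open>Construction of the exponent measure of the mixture\<close>

text \<open>Column \<open>k\<close> of \<open>A\<close> as a diagonal scaling; it may send points of \<open>EE\<close> to the origin.\<close>

definition column_scale :: "real ^ 'r ^ 'd \<Rightarrow> 'r \<Rightarrow> real ^ 'd \<Rightarrow> real ^ 'd" where
  "column_scale A k z = (\<chi> j. A $ j $ k * z $ j)"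

lemma column_scale_measurable [measurable]:
  "column_scale (A :: real ^ 'r ^ 'd::finite) k \<in> borel_measurable borel"
  unfolding column_scale_def
  by (intro borel_measurable_continuous_onI continuous_intros)

text \<open>A sum of image measures, written with explicit preimages because a column with zero
  entries need not map \<open>EE\<close> into itself. Only sets inside \<open>EE\<close> are
  measured, so mass sent to the origin is dropped.\<close>

definition mixture_exponent_measure ::
  "real ^ 'r ^ 'd \<Rightarrow> ('r::finite \<Rightarrow> (real ^ 'd) measure) \<Rightarrow> (real ^ 'd) measure" where
  "mixture_exponent_measure A m = measure_of EE (sets (restrict_space borel EE))
     (\<lambda>B. \<Sum>k\<in>UNIV. emeasure (m k) (column_scale A k -` B \<inter> EE))"

lemma sets_mixture_exponent_measure:
  "sets (mixture_exponent_measure A m) = sets (restrict_space borel (EE :: (real ^ 'd::finite) set))"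
proof -
  have "sets (restrict_space borel EE) \<subseteq> Pow (EE :: (real ^ 'd) set)"
    by (auto simp: sets_restrict_EE)
  then show ?thesis
    unfolding mixture_exponent_measure_def
    using sets.sigma_sets_eq[of "restrict_space borel (EE :: (real ^ 'd) set)"] by simp
qed

text \<open>\<open>measure_of\<close> falls back to the zero measure unless it is given a measure,
  so countable additivity has to be checked: preimages of disjoint sets are disjoint, and the finite
  sum over columns commutes with the series.\<close>

lemma emeasure_mixture_exponent_measure:
  fixes A :: "real ^ 'r::finite ^ 'd::finite"
  assumes m: "\<And>k. is_exponent_measure (\<nu> k) (m k)"
    and B: "B \<in> sets borel" "B \<subseteq> EE"
  shows "emeasure (mixture_exponent_measure A m) B =
    (\<Sum>k\<in>UNIV. emeasure (m k) (column_scale A k -` B \<inter> EE))"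
proof -
  have meas: "column_scale A k -` C \<inter> EE \<in> sets (m k)" if "C \<in> sets borel" for k C
    using measurable_sets[OF column_scale_measurable that, of A k]
    by (auto simp: is_exponent_measureD(1)[OF m])
  show ?thesis
  proof (rule emeasure_measure_of[OF mixture_exponent_measure_def])
    show "sets (restrict_space borel EE) \<subseteq> Pow (EE :: (real ^ 'd) set)"
      by (auto simp: sets_restrict_EE)
    show "B \<in> sets (mixture_exponent_measure A m)"
      by (simp add: sets_mixture_exponent_measure sets_restrict_EE B)
    show "positive (sets (mixture_exponent_measure A m))
        (\<lambda>B. \<Sum>k\<in>UNIV. emeasure (m k) (column_scale A k -` B \<inter> EE))"
      by (simp add: positive_def)
    show "countably_additive (sets (mixture_exponent_measure A m))
        (\<lambda>B. \<Sum>k\<in>UNIV. emeasure (m k) (column_scale A k -` B \<inter> EE))"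
    proof (rule countably_additiveI)
      fix F :: "nat \<Rightarrow> (real ^ 'd) set"
      assume F: "range F \<subseteq> sets (mixture_exponent_measure A m)" "disjoint_family F"
      then have F': "F i \<in> sets borel" for i
        using sets_restrict_EE[of "F i"] by (auto simp: sets_mixture_exponent_measure)
      have "(\<Sum>i. \<Sum>k\<in>UNIV. emeasure (m k) (column_scale A k -` F i \<inter> EE)) =
          (\<Sum>k\<in>UNIV. \<Sum>i. emeasure (m k) (column_scale A k -` F i \<inter> EE))"
        by (rule suminf_sum) auto
      also have "\<dots> = (\<Sum>k\<in>UNIV. emeasure (m k) (column_scale A k -` (\<Union>i. F i) \<inter> EE))"
      proof (rule sum.cong[OF refl])
        fix k
        have "(\<Sum>i. emeasure (m k) (column_scale A k -` F i \<inter> EE)) =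
            emeasure (m k) (\<Union>i. column_scale A k -` F i \<inter> EE)"
          using F(2) meas[OF F'] by (intro suminf_emeasure) (auto simp: disjoint_family_on_def)
        also have "(\<Union>i. column_scale A k -` F i \<inter> EE) = column_scale A k -` (\<Union>i. F i) \<inter> EE"
          by auto
        finally show "(\<Sum>i. emeasure (m k) (column_scale A k -` F i \<inter> EE)) =
            emeasure (m k) (column_scale A k -` (\<Union>i. F i) \<inter> EE)" .
      qed
      finally show "(\<Sum>i. \<Sum>k\<in>UNIV. emeasure (m k) (column_scale A k -` F i \<inter> EE)) =
          (\<Sum>k\<in>UNIV. emeasure (m k) (column_scale A k -` (\<Union>i. F i) \<inter> EE))" .
    qed
  qed
qed

text \<open>The corner of the orthant that \<open>column_scale A k\<close> maps into the orthant with corner \<open>x\<close>;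
  coordinates outside the support of the column impose no constraint.\<close>

definition pulled_corner :: "real ^ 'r ^ 'd \<Rightarrow> 'r \<Rightarrow> ereal ^ 'd \<Rightarrow> ereal ^ 'd" where
  "pulled_corner A k x = (\<chi> j. if A $ j $ k = 0 then \<infinity> else x $ j / ereal (A $ j $ k))"

text \<open>A positive coefficient can be divided out of the inequality; for a zero coefficient both
  sides hold, the left one because the corner is nonnegative.\<close>

lemma column_scale_in_ext_orthant:
  assumes A: "\<And>j. 0 \<le> A $ j $ k" and x: "\<And>j. 0 \<le> x $ j"
  shows "column_scale A k z \<in> ext_orthant x \<longleftrightarrow> z \<in> ext_orthant (pulled_corner A k x)"
proof -
  have "ereal (A $ j $ k * z $ j) \<le> x $ j \<longleftrightarrow> ereal (z $ j) \<le> pulled_corner A k x $ j" for j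
  proof (cases "A $ j $ k = 0")
    case True
    then show ?thesis using x[of j] by (simp add: pulled_corner_def zero_ereal_def[symmetric])
  next
    case False
    then have "0 < A $ j $ k" using A[of j] by simp
    then show ?thesis
      using ereal_le_divide_pos[of "ereal (A $ j $ k)" "ereal (z $ j)" "x $ j"]
      by (simp add: pulled_corner_def)
  qed
  then show ?thesis by (simp add: ext_orthant_def column_scale_def)
qed

lemma pulled_corner_nonneg:
  assumes "\<And>j. 0 \<le> A $ j $ k" "\<And>j. 0 \<le> x $ j"
  shows "0 \<le> pulled_corner A k x $ j"
  using assms(1)[of j] assms(2)[of j] by (auto simp: pulled_corner_def zero_le_divide_ereal)

lemma pulled_corner_pos:
  assumes "\<And>j. 0 \<le> A $ j $ k" "\<And>j. 0 < x $ j"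
  shows "0 < pulled_corner A k x $ j"
  using assms(1)[of j] assms(2)[of j]
  by (cases "x $ j") (auto simp: pulled_corner_def)

section \<open>Orthant probabilities and exponent measure of the mixture\<close>

lemma mixture_model_in_ext_orthant:
  fixes Z :: "'r::finite \<Rightarrow> 'a \<Rightarrow> real ^ 'd::finite"
  shows "mixture_model A Z \<omega> \<in> ext_orthant x \<longleftrightarrow> (\<forall>k. column_scale A k (Z k \<omega>) \<in> ext_orthant x)"
proof -
  have *: "ereal (Max (range f)) \<le> c \<longleftrightarrow> (\<forall>k. ereal (f k) \<le> c)" for f :: "'r \<Rightarrow> real" and c
  proof -
    have "\<exists>k. Max (range f) = f k" using Max_in[of "range f"] by (simp add: image_iff)
    moreover have "f k \<le> Max (range f)" for k by simp
    ultimately show ?thesis by (metis ereal_less_eq(3) order_trans)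
  qed
  show ?thesis by (auto simp: ext_orthant_def mixture_model_def column_scale_def *)
qed

lemma mixture_model_measurable:
  fixes Z :: "'r::finite \<Rightarrow> 'a \<Rightarrow> real ^ 'd::finite"
  assumes Z: "\<And>k. Z k \<in> borel_measurable M"
  shows "mixture_model A Z \<in> borel_measurable M"
proof -
  have nth: "(\<lambda>z. z $ j) \<in> borel_measurable (borel :: (real ^ 'd) measure)" for j
    by measurable
  have coord: "(\<lambda>\<omega>. A $ j $ k * Z k \<omega> $ j) \<in> borel_measurable M" for k j
    by (rule borel_measurable_times[OF borel_measurable_const measurable_compose[OF Z nth]])
  have max: "(\<lambda>\<omega>. Max ((\<lambda>k. A $ j $ k * Z k \<omega> $ j) ` UNIV)) \<in> borel_measurable M" for j
    by (rule borel_measurable_Max[OF finite coord])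
  show ?thesis
  proof (rule borel_measurable_euclidean_space[THEN iffD2, rule_format])
    fix i :: "real ^ 'd" assume "i \<in> Basis"
    then obtain j where "i = axis j 1" by (auto simp: Basis_vec_def)
    then have "(\<lambda>\<omega>. mixture_model A Z \<omega> \<bullet> i) = (\<lambda>\<omega>. Max ((\<lambda>k. A $ j $ k * Z k \<omega> $ j) ` UNIV))"
      by (simp only: inner_axis mixture_model_def vec_lambda_beta inner_real_def mult_1_right)
    then show "(\<lambda>\<omega>. mixture_model A Z \<omega> \<bullet> i) \<in> borel_measurable M"
      by (simp only: max)
  qed
qed

text \<open>A maximum respects a bound iff all its terms do, so the event is an intersection of
  events about the single factors, to which independence applies.\<close>

lemma mixture_model_ext_orthant_prob:
  fixes Z :: "'r::finite \<Rightarrow> 'a \<Rightarrow> real ^ 'd::finite"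
  assumes P: "prob_space P" and ind: "prob_space.indep_vars P (\<lambda>_. borel) Z UNIV"
    and A: "\<And>j k. 0 \<le> A $ j $ k" and x: "\<And>j. 0 \<le> x $ j"
  shows "measure (distr P borel (mixture_model A Z)) (ext_orthant x) =
    (\<Prod>k\<in>UNIV. measure (distr P borel (Z k)) (ext_orthant (pulled_corner A k x)))"
proof -
  interpret prob_space P by fact
  have Z [measurable]: "Z k \<in> borel_measurable P" for k
    using ind by (simp add: indep_vars_def)
  have "measure (distr P borel (mixture_model A Z)) (ext_orthant x) =
      prob (mixture_model A Z -` ext_orthant x \<inter> space P)"
    by (rule measure_distr) (auto intro: mixture_model_measurable)
  also have "mixture_model A Z -` ext_orthant x \<inter> space P =
      (\<Inter>k\<in>UNIV. Z k -` ext_orthant (pulled_corner A k x) \<inter> space P)"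
    by (auto simp: mixture_model_in_ext_orthant column_scale_in_ext_orthant[OF A x])
  also have "prob \<dots> = (\<Prod>k\<in>UNIV. prob (Z k -` ext_orthant (pulled_corner A k x) \<inter> space P))"
    by (rule indep_varsD[OF ind]) auto
  also have "\<dots> = (\<Prod>k\<in>UNIV. measure (distr P borel (Z k)) (ext_orthant (pulled_corner A k x)))"
    by (intro prod.cong refl measure_distr[symmetric]) auto
  finally show ?thesis .
qed

lemma mixture_exponent_measure:
  fixes Z :: "'r::finite \<Rightarrow> 'a \<Rightarrow> real ^ 'd::finite"
  assumes P: "prob_space P" and ind: "prob_space.indep_vars P (\<lambda>_. borel) Z UNIV"
    and A: "\<And>j k. 0 \<le> A $ j $ k"
    and m: "\<And>k. is_exponent_measure (distr P borel (Z k)) (m k)"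
  shows "is_exponent_measure (distr P borel (mixture_model A Z)) (mixture_exponent_measure A m)"
  unfolding is_exponent_measure_def
proof (intro conjI allI impI)
  show "sets (mixture_exponent_measure A m) = sets (restrict_space borel EE)"
    by (rule sets_mixture_exponent_measure)
  fix x :: "ereal ^ 'd" assume "\<forall>j. 0 \<le> x $ j"
  then have x: "0 \<le> x $ j" for j by simp
  have "column_scale A k -` (EE - ext_orthant x) \<inter> EE = EE - ext_orthant (pulled_corner A k x)" for k
  proof -
    have "column_scale A k z \<in> EE" if "z \<in> EE" "column_scale A k z \<notin> ext_orthant x" for z
    proof -
      \<comment> \<open>The origin lies in every orthant with nonnegative corner, so no point with
        image outside the orthant is lost by dropping the origin.\<close>
      have "column_scale A k z \<noteq> 0"
        using that(2) x by (auto simp: ext_orthant_def zero_ereal_def[symmetric])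
      then show ?thesis using that(1) A by (auto simp: EE_def column_scale_def)
    qed
    then show ?thesis by (auto simp: column_scale_in_ext_orthant[OF A x, symmetric])
  qed
  then have "emeasure (mixture_exponent_measure A m) (EE - ext_orthant x) =
      (\<Sum>k\<in>UNIV. emeasure (m k) (EE - ext_orthant (pulled_corner A k x)))"
    by (subst emeasure_mixture_exponent_measure[OF m]) auto
  then show "measure (distr P borel (mixture_model A Z)) (ext_orthant x) =
      exp_neg (emeasure (mixture_exponent_measure A m) (EE - ext_orthant x))"
    by (simp add: mixture_model_ext_orthant_prob[OF P ind A x] exp_neg_sum
        is_exponent_measureD(3)[OF m pulled_corner_nonneg[OF A x]])
qed

section \<open>Faces under column scaling, and the extreme directions\<close>

text \<open>All coordinates of \<open>z\<close> are positive, so the image has the sign pattern of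
  the column. Nonemptiness of \<open>J\<close> excludes a zero column, whose image is the origin and
  lies on no face.\<close>

lemma column_scale_EE_face_iff:
  assumes z: "z \<in> EE_face UNIV" and A: "\<And>j. 0 \<le> A $ j $ k" and J: "J \<noteq> {}"
  shows "column_scale A k z \<in> EE_face J \<longleftrightarrow> J = {j. 0 < A $ j $ k}"
proof -
  have zp: "0 < z $ j" for j using z by (simp add: EE_face_def)
  have p: "0 < column_scale A k z $ j \<longleftrightarrow> 0 < A $ j $ k" for j
    using zp[of j] by (simp add: column_scale_def zero_less_mult_iff less_imp_not_less)
  have nn: "0 \<le> column_scale A k z $ j" for j
    using A[of j] zp[of j] by (simp add: column_scale_def)
  show ?thesis
  proof
    assume "column_scale A k z \<in> EE_face J"
    then show "J = {j. 0 < A $ j $ k}" using p by (auto simp: EE_face_def)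
  next
    assume eq: "J = {j. 0 < A $ j $ k}"
    then obtain j where "0 < A $ j $ k" using J by auto
    then have "column_scale A k z \<noteq> 0" using p[of j] by auto
    then show "column_scale A k z \<in> EE_face J" using p nn eq by (simp add: EE_face_def EE_def)
  qed
qed

text \<open>Up to the null set outside the open face, the preimage is either the whole open face or
  empty.\<close>

lemma emeasure_column_scale_EE_face:
  fixes A :: "real ^ 'r ^ 'd::finite"
  assumes \<mu>: "is_exponent_measure \<nu> \<mu>" and dir: "extreme_directions \<nu> \<subseteq> {UNIV}"
    and A: "\<And>j. 0 \<le> A $ j $ k" and J: "J \<noteq> {}"
  shows "emeasure \<mu> (column_scale A k -` EE_face J \<inter> EE) =
    (if J = {j. 0 < A $ j $ k} then emeasure \<mu> (EE_face UNIV) else 0)"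
proof -
  define S where "S = column_scale A k -` EE_face J \<inter> EE"
  define Q :: "(real ^ 'd) set" where "Q = EE_face UNIV"
  have S: "S \<in> sets \<mu>"
    using measurable_sets[OF column_scale_measurable EE_face_measurable, of A k J]
    by (auto simp: S_def is_exponent_measureD(1)[OF \<mu>])
  have Q: "Q \<in> sets \<mu>" by (simp add: Q_def is_exponent_measureD(1)[OF \<mu>] EE_face_subset)
  have "EE - Q \<in> null_sets \<mu>"
    using exponent_measure_full_support[OF \<mu> dir] by (auto simp: Q_def is_exponent_measureD(1)[OF \<mu>])
  then have "emeasure \<mu> S = emeasure \<mu> (S - (EE - Q))" using S by (simp add: emeasure_Diff_null_set)
  also have "S - (EE - Q) = (if J = {j. 0 < A $ j $ k} then Q else {})"
    using column_scale_EE_face_iff[OF _ A J] EE_face_subset[of UNIV] by (auto simp: S_def Q_def)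
  finally show ?thesis by (auto simp: S_def Q_def)
qed

theorem proposition4p5:
  fixes P :: "'a measure"
    and Z :: "'r::finite \<Rightarrow> 'a \<Rightarrow> real ^ 'd::finite"
    and A :: "real ^ 'r ^ 'd"
  assumes "prob_space P"
    and "prob_space.indep_vars P (\<lambda>_. borel) Z UNIV"
    and "\<And>k. mev (distr P borel (Z k))"
    and "\<And>k. unit_frechet_margins (distr P borel (Z k))"
    and "\<And>k. extreme_directions (distr P borel (Z k)) = {UNIV}"
    and "\<And>j k. 0 \<le> A $ j $ k \<and> A $ j $ k \<le> 1"
    and "\<And>j. (\<Sum>k\<in>UNIV. A $ j $ k) = 1"
    and "\<And>k. (\<Sum>j\<in>UNIV. A $ j $ k) > 0"
  shows "extreme_directions (distr P borel (mixture_model A Z)) =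
           {J. \<exists>k. J = {j. A $ j $ k > 0}}"
proof -
  let ?\<nu> = "distr P borel (mixture_model A Z)"
  have A: "0 \<le> A $ j $ k" for j k using assms(6) by simp
  have dir: "extreme_directions (distr P borel (Z k)) \<subseteq> {UNIV}" for k using assms(5) by simp
  have "\<exists>\<mu>. is_exponent_measure (distr P borel (Z k)) \<mu> \<and> 0 < emeasure \<mu> (EE_face UNIV)" for k
    using assms(5)[of k] unfolding extreme_directions_def by blast
  then obtain m where m: "\<And>k. is_exponent_measure (distr P borel (Z k)) (m k)"
    and m_pos: "\<And>k. 0 < emeasure (m k) (EE_face UNIV)" by metis
  let ?\<mu> = "mixture_exponent_measure A m"
  have \<mu>: "is_exponent_measure ?\<nu> ?\<mu>"
    by (rule mixture_exponent_measure[OF assms(1,2) A m])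
  \<comment> \<open>This is the hypothesis of uniqueness: each factor probability is positive
    because the mass outside an orthant with positive corner is finite.\<close>
  have "0 < measure ?\<nu> (ext_orthant x)" if x: "\<And>j. 0 < x $ j" for x
  proof -
    have "0 < measure (distr P borel (Z k)) (ext_orthant (pulled_corner A k x))" for k
      using exponent_measure_orthant_finite[OF m assms(4) _ pulled_corner_pos[OF A x]]
      by (simp add: is_exponent_measureD(3)[OF m] exp_neg_pos_iff pulled_corner_pos[OF A x] less_imp_le)
    then show ?thesis
      by (simp add: mixture_model_ext_orthant_prob[OF assms(1,2) A] x less_imp_le prod_pos)
  qed
  then have unique: "\<mu>' = ?\<mu>" if "is_exponent_measure ?\<nu> \<mu>'" for \<mu>'
    using exponent_measure_unique[OF that \<mu>] by blast
  \<comment> \<open>Positive column sums make every column support nonempty, as an extreme direction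
    must be.\<close>
  have col: "{j. 0 < A $ j $ k} \<noteq> {}" for k
  proof
    assume "{j. 0 < A $ j $ k} = {}"
    then have "(\<Sum>j\<in>UNIV. A $ j $ k) \<le> 0" by (intro sum_nonpos) (auto simp: not_less)
    then show False using assms(8)[of k] by simp
  qed
  have face: "0 < emeasure ?\<mu> (EE_face J) \<longleftrightarrow> (\<exists>k. J = {j. 0 < A $ j $ k})" if "J \<noteq> {}" for J
  proof -
    \<comment> \<open>Each column with support \<open>J\<close> contributes the strictly positive
      mass of its open face and all others contribute 0, so the sum is positive iff some column
      matches.\<close>
    have "emeasure ?\<mu> (EE_face J) =
        (\<Sum>k\<in>UNIV. if J = {j. 0 < A $ j $ k} then emeasure (m k) (EE_face UNIV) else 0)"
      by (simp add: emeasure_mixture_exponent_measure[OF m] EE_face_subset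
          emeasure_column_scale_EE_face[OF m dir A that])
    then show ?thesis using m_pos by (auto simp: zero_less_iff_neq_zero split: if_splits)
  qed
  show ?thesis
  proof (rule set_eqI)
    fix J :: "'d set"
    \<comment> \<open>Uniqueness replaces the existential over exponent measures by the constructed
      one.\<close>
    have "J \<in> extreme_directions ?\<nu> \<longleftrightarrow> J \<noteq> {} \<and> 0 < emeasure ?\<mu> (EE_face J)"
      using \<mu> by (auto simp: extreme_directions_def dest: unique)
    also have "\<dots> \<longleftrightarrow> (\<exists>k. J = {j. 0 < A $ j $ k})"
      using face[of J] col by metis
    finally show "J \<in> extreme_directions ?\<nu> \<longleftrightarrow> J \<in> {J. \<exists>k. J = {j. A $ j $ k > 0}}"
      by (simp only: mem_Collect_eq)
  qed
qed

end
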